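(* Let $K$ be a field of characteristic zero and let $A=K\langle x_1,x_2\rangle$ be the free associative algebra with identity in two variables. The endomorphism $\beta$ of $A$ given by $$\beta=(x_1+[x_1,x_2]^2,\ x_2),$$ i.e. $\beta(x_1)=x_1+[x_1,x_2]^2$, $\beta(x_2)=x_2$, induces an absolutely wild automorphism of the free algebra of rank two of the variety $\mathrm{Var}(M_2(K))$ generated by the matrix algebra $M_2(K)$.
   Context: $[a,b]=ab-ba$. The free algebra of rank two of $\mathrm{Var}(M_2(K))$ is $B=A/I$, where $I$ is the ideal of all polynomial identities of $M_2(K)$ in the two variables $x_1,x_2$; write $z_1,z_2$ for the images of $x_1,x_2$. $B=B_0\oplus B_1\oplus\cdots$ is graded by degree in $z_1,z_2$, with $B_0=K$. An automorphism of $B$ of the form $(\alpha z_1+f(z_2),z_2)$ or $(z_1,\alpha z_2+f(z_1))$ with $0\ne\alpha\in K$ and $f$ a polynomial in one variable over $K$ is called elementary; tame automorphisms are the elements of the subgroup of $\mathrm{Aut}(B)$ generated by elementary automorphisms. For $k\ge1$, $\mathrm{IA}(B,k)$ is the group of automorphisms $\phi$ of $B$ with $\phi(z_j)-z_j\in B_{k+1}+B_{k+2}+\cdots$ for $j=1,2$. An automorphism $\phi$ of $B$ is approximately tame if there is a sequence of tame automorphisms $\psi_k$ of $B$ with $\phi\psi_k^{-1}\in\mathrm{IA}(B,k)$ for all $k$; it is absolutely wild if it is not approximately tame. *)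

theory Defs
  imports
    "HOL-Analysis.Analysis"
    "HOL-Algebra.Generated_Groups"
    "HOL-Computational_Algebra.Polynomial"
    "HOL-Library.Poly_Mapping"
begin

section \<open>The free associative algebra in two variables\<close>

text \<open>
  Words form the free monoid, written additively because \<^typ>\<open>'a \<Rightarrow>\<^sub>0 'b\<close> takes its convolution
  product over an additive monoid.  This \<^emph>\<open>noncommutative\<close> addition on lists is concatenation.
\<close>

instantiation list :: (type) monoid_add
begin
definition zero_list :: "'a list" where "zero_list = []"
definition plus_list :: "'a list \<Rightarrow> 'a list \<Rightarrow> 'a list" where "plus_list = (@)"
instance by standard (simp_all add: zero_list_def plus_list_def)
end

datatype letter = X1 | X2

type_synonym 'k free_alg = "letter list \<Rightarrow>\<^sub>0 'k"

definition scal :: "'k \<Rightarrow> 'k::field free_alg" where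
  "scal c = Poly_Mapping.single [] c"

definition x1 :: "'k::field free_alg" where "x1 = Poly_Mapping.single [X1] 1"
definition x2 :: "'k::field free_alg" where "x2 = Poly_Mapping.single [X2] 1"

definition commutator :: "'a::ring_1 \<Rightarrow> 'a \<Rightarrow> 'a" where
  "commutator a b = a * b - b * a"

text \<open>Unital algebra endomorphisms of a ring with scalar multiplication \<open>sm\<close>.\<close>

definition alg_endo :: "('k \<Rightarrow> 'r \<Rightarrow> 'r) \<Rightarrow> ('r::ring_1 \<Rightarrow> 'r) \<Rightarrow> bool" where
  "alg_endo sm \<phi> \<longleftrightarrow> \<phi> 1 = 1 \<and> (\<forall>a b. \<phi> (a + b) = \<phi> a + \<phi> b) \<and>
     (\<forall>a b. \<phi> (a * b) = \<phi> a * \<phi> b) \<and> (\<forall>c a. \<phi> (sm c a) = sm c (\<phi> a))"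

text \<open>
  \<open>endo u v\<close> is the endomorphism \<open>(u, v)\<close>, that is, the substitution \<open>x1 \<mapsto> u\<close>, \<open>x2 \<mapsto> v\<close>;
  see \<open>alg_endo_endo\<close>, \<open>endo_x1\<close>, \<open>endo_x2\<close> and \<open>alg_endo_unique\<close> below.
\<close>

definition word_subst :: "'k::field free_alg \<Rightarrow> 'k free_alg \<Rightarrow> letter list \<Rightarrow> 'k free_alg" where
  "word_subst u v w = prod_list (map (case_letter u v) w)"

definition endo :: "'k::field free_alg \<Rightarrow> 'k free_alg \<Rightarrow> 'k free_alg \<Rightarrow> 'k free_alg" where
  "endo u v f =
     (\<Sum>w \<in> Poly_Mapping.keys f. scal (Poly_Mapping.lookup f w) * word_subst u v w)"

lemma free_alg_expand:
  "f = (\<Sum>w \<in> Poly_Mapping.keys f. Poly_Mapping.single w (Poly_Mapping.lookup f w))"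
  by (rule poly_mapping_eqI)
     (auto simp: lookup_sum lookup_single when_def in_keys_iff)

lemma free_alg_induct [case_names single add]:
  fixes f :: "'k::field free_alg"
  assumes "\<And>w c. P (Poly_Mapping.single w c)" and "\<And>f g. P f \<Longrightarrow> P g \<Longrightarrow> P (f + g)"
  shows "P f"
proof -
  have P0: "P 0" using assms(1)[of "[]" 0] by simp
  have "P (\<Sum>w \<in> S. Poly_Mapping.single w (Poly_Mapping.lookup f w))" if "finite S" for S
    using that by (induction S) (auto simp: P0 assms)
  from this[OF finite_keys] show ?thesis by (subst free_alg_expand) blast
qed

lemma scal_mult_single:
  "scal c * Poly_Mapping.single w d = Poly_Mapping.single w (c * d)"
  by (simp add: scal_def mult_single plus_list_def)

lemma scal_central: "scal c * f = f * scal c"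
proof (induction f rule: free_alg_induct)
  case (single w d)
  then show ?case by (simp add: scal_def mult_single plus_list_def mult.commute)
next
  case (add f g)
  then show ?case by (simp add: algebra_simps)
qed

lemma single_Nil_1: "Poly_Mapping.single ([] :: letter list) (1::'k::field) = 1"
  by (simp add: zero_list_def [symmetric])

lemma scal_0 [simp]: "scal 0 = 0" by (simp add: scal_def)
lemma scal_1 [simp]: "scal 1 = 1"
  by (simp add: scal_def single_Nil_1)
lemma scal_add: "scal (a + b) = scal a + scal b" by (simp add: scal_def single_add)
lemma scal_mult: "scal (a * b) = scal a * scal b"
  by (simp add: scal_def mult_single plus_list_def)

lemma word_subst_append: "word_subst u v (w @ w') = word_subst u v w * word_subst u v w'"
  by (simp add: word_subst_def)

lemma endo_add: "endo u v (f + g) = endo u v f + endo u v g"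
  unfolding endo_def by (rule setsum_keys_plus_distrib) (simp_all add: scal_add algebra_simps)

lemma endo_single: "endo u v (Poly_Mapping.single w c) = scal c * word_subst u v w"
  by (cases "c = 0") (simp_all add: endo_def)

lemma endo_mult: "endo u v (f * g) = endo u v f * endo u v g"
proof (induction f rule: free_alg_induct)
  case (single w c)
  show ?case
  proof (induction g rule: free_alg_induct)
    case (single w' d)
    have "scal d * (word_subst u v w * word_subst u v w')
        = word_subst u v w * (scal d * word_subst u v w')"
      using scal_central [of d "word_subst u v w"] by (simp only: mult.assoc [symmetric])
    then show ?case
      by (simp add: mult_single plus_list_def endo_single word_subst_append scal_mult mult.assoc)
  qed (simp add: endo_add distrib_left)
qed (simp add: endo_add distrib_right)

lemma alg_endo_endo: "alg_endo (\<lambda>c f. scal c * f) (endo u v)"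
proof -
  have s: "endo u v (scal c) = scal c" for c
    by (simp add: scal_def [of c] endo_single) (simp add: scal_def word_subst_def)
  have "endo u v 1 = 1" using s[of 1] by simp
  then show ?thesis by (auto simp: alg_endo_def endo_add endo_mult s)
qed

lemma endo_x1 [simp]: "endo u v x1 = u"
  by (simp add: x1_def endo_single word_subst_def)

lemma endo_x2 [simp]: "endo u v x2 = v"
  by (simp add: x2_def endo_single word_subst_def)

lemma alg_endo_unique:
  assumes "alg_endo (\<lambda>c f. scal c * f) \<phi>"
  shows "\<phi> = endo (\<phi> x1) (\<phi> x2)"
proof
  fix f
  have w: "\<phi> (Poly_Mapping.single w 1) = word_subst (\<phi> x1) (\<phi> x2) w" for w
  proof (induction w)
    case Nil
    then show ?case using assms
      by (simp add: word_subst_def alg_endo_def single_Nil_1)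
  next
    case (Cons a w)
    have "Poly_Mapping.single (a # w) 1 = (case a of X1 \<Rightarrow> x1 | X2 \<Rightarrow> x2) * Poly_Mapping.single w (1::'a)"
      by (cases a) (simp_all add: x1_def x2_def mult_single plus_list_def)
    then show ?case using assms Cons
      by (cases a) (simp_all add: alg_endo_def word_subst_def)
  qed
  show "\<phi> f = endo (\<phi> x1) (\<phi> x2) f"
  proof (induction f rule: free_alg_induct)
    case (single w c)
    have "\<phi> (scal c * Poly_Mapping.single w 1) = scal c * word_subst (\<phi> x1) (\<phi> x2) w"
      using assms w[of w] unfolding alg_endo_def by metis
    then show ?case by (simp add: scal_mult_single endo_single)
  next
    case (add f g)
    then show ?case using assms by (simp add: alg_endo_def endo_add)
  qed
qed


section \<open>Polynomial identities of the algebra of two-by-two matrices\<close>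

text \<open>Ring multiplication on \<^typ>\<open>'k^2^2\<close> is componentwise; the matrix product is \<open>**\<close>.\<close>

fun word_eval :: "'k::field^2^2 \<Rightarrow> 'k^2^2 \<Rightarrow> letter list \<Rightarrow> 'k^2^2" where
  "word_eval P Q [] = mat 1"
| "word_eval P Q (a # w) = (case a of X1 \<Rightarrow> P | X2 \<Rightarrow> Q) ** word_eval P Q w"

definition mat_eval :: "'k::field^2^2 \<Rightarrow> 'k^2^2 \<Rightarrow> 'k free_alg \<Rightarrow> 'k^2^2" where
  "mat_eval P Q f =
     (\<Sum>w \<in> Poly_Mapping.keys f. mat (Poly_Mapping.lookup f w) ** word_eval P Q w)"

definition identities :: "'k::field free_alg set" where
  "identities = {f. \<forall>P Q. mat_eval P Q f = 0}"

lemma mat_add: "mat (a + b) = mat a + (mat b :: 'k::field^2^2)"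
  by (simp add: mat_def vec_eq_iff)

lemma mat_zero [simp]: "mat 0 = (0 :: 'k::field^2^2)"
  by (simp add: mat_def vec_eq_iff)

lemma mat_nth_mult: "mat c ** (M :: 'k::field^2^2) = (\<chi> i j. c * M $ i $ j)"
  by (auto simp: mat_def matrix_matrix_mult_def vec_eq_iff sum_2 forall_2)

lemma mult_mat_nth: "(M :: 'k::field^2^2) ** mat c = (\<chi> i j. c * M $ i $ j)"
  by (auto simp: mat_def matrix_matrix_mult_def vec_eq_iff sum_2 forall_2)

lemma mat_mult_mat: "mat (a * b) = mat a ** (mat b :: 'k::field^2^2)"
  by (simp add: mat_nth_mult) (simp add: mat_def vec_eq_iff)

lemma mat_central: "mat c ** (M :: 'k::field^2^2) = M ** mat c"
  by (simp add: mat_nth_mult mult_mat_nth)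

lemma matrix_distrib_right: "(A + B) ** (C :: 'k::field^2^2) = A ** C + B ** C"
  by (simp add: matrix_matrix_mult_def vec_eq_iff distrib_right sum.distrib)

lemma word_eval_append: "word_eval P Q (w @ w') = word_eval P Q w ** word_eval P Q w'"
  by (induction w) (simp_all add: matrix_mul_assoc)

lemma mat_eval_add: "mat_eval P Q (f + g) = mat_eval P Q f + mat_eval P Q g"
  unfolding mat_eval_def
  by (rule setsum_keys_plus_distrib) (simp_all add: mat_add matrix_distrib_right)

lemma mat_eval_single: "mat_eval P Q (Poly_Mapping.single w c) = mat c ** word_eval P Q w"
  by (cases "c = 0") (simp_all add: mat_eval_def)

lemma mat_eval_0 [simp]: "mat_eval P Q 0 = 0" by (simp add: mat_eval_def)

lemma mat_eval_1 [simp]: "mat_eval P Q 1 = mat 1"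
  using mat_eval_single[of P Q "[]" 1] by (simp add: single_Nil_1)

lemma mat_eval_mult: "mat_eval P Q (f * g) = mat_eval P Q f ** mat_eval P Q g"
proof (induction f rule: free_alg_induct)
  case (single w c)
  show ?case
  proof (induction g rule: free_alg_induct)
    case (single w' d)
    have "mat d ** (word_eval P Q w ** word_eval P Q w')
        = word_eval P Q w ** (mat d ** word_eval P Q w')"
      using mat_central [of d "word_eval P Q w"] by (simp only: matrix_mul_assoc)
    then show ?case
      by (simp add: mult_single plus_list_def mat_eval_single word_eval_append mat_mult_mat
          flip: matrix_mul_assoc)
  qed (simp add: mat_eval_add distrib_left matrix_add_ldistrib)
qed (simp add: mat_eval_add distrib_right matrix_distrib_right)

lemma mat_eval_uminus: "mat_eval P Q (- f) = - mat_eval P Q f"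
  using mat_eval_add[of P Q f "- f"] by (simp add: eq_neg_iff_add_eq_0 add.commute)

lemma mat_eval_diff: "mat_eval P Q (f - g) = mat_eval P Q f - mat_eval P Q g"
  using mat_eval_add[of P Q f "- g"] by (simp add: mat_eval_uminus)

lemma diff_mem_identities: "f - g \<in> identities \<longleftrightarrow> (\<forall>P Q. mat_eval P Q f = mat_eval P Q g)"
  by (simp add: identities_def mat_eval_diff)


section \<open>The relatively free algebra of rank two\<close>

quotient_type (overloaded) 'k rel_free = "'k::field free_alg" /
  "\<lambda>f g. f - g \<in> (identities :: 'k free_alg set)" morphisms rep_rel_free proj
  by (rule equivpI) (auto simp: reflp_def symp_def transp_def diff_mem_identities)

instantiation rel_free :: (field) ring_1
begin

lift_definition zero_rel_free :: "'a rel_free" is 0 .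
lift_definition one_rel_free :: "'a rel_free" is 1 .
lift_definition plus_rel_free :: "'a rel_free \<Rightarrow> 'a rel_free \<Rightarrow> 'a rel_free" is "(+)"
  by (simp add: diff_mem_identities mat_eval_add)
lift_definition minus_rel_free :: "'a rel_free \<Rightarrow> 'a rel_free \<Rightarrow> 'a rel_free" is "(-)"
  by (simp add: diff_mem_identities mat_eval_diff)
lift_definition uminus_rel_free :: "'a rel_free \<Rightarrow> 'a rel_free" is uminus
  unfolding diff_mem_identities by (simp add: mat_eval_uminus)
lift_definition times_rel_free :: "'a rel_free \<Rightarrow> 'a rel_free \<Rightarrow> 'a rel_free" is "(*)"
  by (simp add: diff_mem_identities mat_eval_mult)

instance
proof
  show "(0 :: 'a rel_free) \<noteq> 1"
  proof (transfer, unfold diff_mem_identities)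
    have "(0 :: 'a^2^2) \<noteq> mat 1" by (auto simp: mat_def vec_eq_iff)
    then show "\<not> (\<forall>P Q. mat_eval P Q (0 :: 'a free_alg) = mat_eval P Q 1)" by simp
  qed
qed (transfer; unfold diff_mem_identities; simp add: algebra_simps)+

end

definition rscale :: "'k::field \<Rightarrow> 'k rel_free \<Rightarrow> 'k rel_free" where
  "rscale c b = proj (scal c) * b"

definition z1 :: "'k::field rel_free" where "z1 = proj x1"
definition z2 :: "'k::field rel_free" where "z2 = proj x2"

text \<open>The homogeneous component \<open>B\<^sub>n\<close>, and the sum of all \<open>B\<^sub>n\<close> with \<open>n \<ge> m\<close>.\<close>

definition component :: "nat \<Rightarrow> 'k::field rel_free set" where
  "component n = proj ` {f. \<forall>w \<in> Poly_Mapping.keys f. length w = n}"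

definition components_from :: "nat \<Rightarrow> 'k::field rel_free set" where
  "components_from m =
     {b. \<exists>N c. (\<forall>n. c n \<in> component n) \<and> b = (\<Sum>n = m..<N. c n)}"

definition poly_at :: "'k::field poly \<Rightarrow> 'k rel_free \<Rightarrow> 'k rel_free" where
  "poly_at f b = (\<Sum>i \<le> degree f. rscale (coeff f i) (b ^ i))"


section \<open>Automorphisms\<close>

definition Aut :: "('k::field rel_free \<Rightarrow> 'k rel_free) monoid" where
  "Aut = \<lparr>carrier = {\<phi>. alg_endo rscale \<phi> \<and> bij \<phi>}, mult = (\<circ>), one = id\<rparr>"

lemma group_Aut: "group Aut"
proof (rule groupI)
  fix \<phi> :: "'k::field rel_free \<Rightarrow> 'k rel_free"
  assume "\<phi> \<in> carrier Aut"
  then have *: "alg_endo rscale \<phi>" "bij \<phi>" by (auto simp: Aut_def)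
  let ?\<psi> = "inv_into UNIV \<phi>"
  have r: "\<phi> (?\<psi> b) = b" for b using *(2) by (simp add: bij_is_surj surj_f_inv_f)
  have i: "\<phi> a = \<phi> b \<Longrightarrow> a = b" for a b using *(2) by (simp add: bij_is_inj inj_eq)
  have "alg_endo rscale ?\<psi>"
    unfolding alg_endo_def
  proof (intro conjI allI)
    show "?\<psi> 1 = 1" by (rule i) (use *(1) in \<open>simp add: r alg_endo_def\<close>)
    show "?\<psi> (a + b) = ?\<psi> a + ?\<psi> b" for a b
      by (rule i) (use *(1) in \<open>simp add: r alg_endo_def\<close>)
    show "?\<psi> (a * b) = ?\<psi> a * ?\<psi> b" for a b
      by (rule i) (use *(1) in \<open>simp add: r alg_endo_def\<close>)
    show "?\<psi> (rscale c a) = rscale c (?\<psi> a)" for c a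
      by (rule i) (use *(1) in \<open>simp add: r alg_endo_def\<close>)
  qed
  moreover have "?\<psi> \<circ> \<phi> = id" using *(2) by (simp add: bij_is_inj)
  ultimately show "\<exists>\<psi> \<in> carrier Aut. \<psi> \<otimes>\<^bsub>Aut\<^esub> \<phi> = \<one>\<^bsub>Aut\<^esub>"
    using *(2) by (auto simp: Aut_def intro!: bexI[of _ ?\<psi>] bij_imp_bij_inv)
qed (auto simp: Aut_def alg_endo_def intro: bij_comp)

definition elementary :: "('k::field rel_free \<Rightarrow> 'k rel_free) set" where
  "elementary = {\<phi> \<in> carrier Aut. \<exists>\<alpha> f. \<alpha> \<noteq> 0 \<and>
     (\<phi> z1 = rscale \<alpha> z1 + poly_at f z2 \<and> \<phi> z2 = z2 \<or>
      \<phi> z1 = z1 \<and> \<phi> z2 = rscale \<alpha> z2 + poly_at f z1)}"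

definition tame :: "('k::field rel_free \<Rightarrow> 'k rel_free) set" where
  "tame = generate Aut elementary"

definition IA :: "nat \<Rightarrow> ('k::field rel_free \<Rightarrow> 'k rel_free) set" where
  "IA k = {\<phi> \<in> carrier Aut. \<phi> z1 - z1 \<in> components_from (k + 1) \<and>
                            \<phi> z2 - z2 \<in> components_from (k + 1)}"

definition approximately_tame :: "('k::field rel_free \<Rightarrow> 'k rel_free) \<Rightarrow> bool" where
  "approximately_tame \<phi> \<longleftrightarrow> \<phi> \<in> carrier Aut \<and>
     (\<exists>\<psi> :: nat \<Rightarrow> _. \<forall>k \<ge> 1. \<psi> k \<in> tame \<and> \<phi> \<otimes>\<^bsub>Aut\<^esub> inv\<^bsub>Aut\<^esub> (\<psi> k) \<in> IA k)"

definition absolutely_wild :: "('k::field rel_free \<Rightarrow> 'k rel_free) \<Rightarrow> bool" where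
  "absolutely_wild \<phi> \<longleftrightarrow> \<phi> \<in> carrier Aut \<and> \<not> approximately_tame \<phi>"

definition induces ::
  "('k::field free_alg \<Rightarrow> 'k free_alg) \<Rightarrow> ('k rel_free \<Rightarrow> 'k rel_free) \<Rightarrow> bool" where
  "induces \<beta> \<phi> \<longleftrightarrow> (\<forall>f. \<phi> (proj f) = proj (\<beta> f))"

end

theory Submission
  imports Defs
begin

text \<open>
  Every tame automorphism of the relatively free algebra \<open>B\<close> lifts to an endomorphism \<open>(u, v)\<close> of
  the free algebra with \<open>[u, v] = a [x\<^sub>1, x\<^sub>2]\<close> for a scalar \<open>a\<close>, since this holds for elementary
  automorphisms.  As two-by-two matrices satisfy no identity in two variables of degree below 5, a
  tame approximation of \<open>(x\<^sub>1 + [x\<^sub>1, x\<^sub>2]\<^sup>2, x\<^sub>2)\<close> modulo degree 5 in \<open>B\<close> lifts to \<open>(u, v)\<close> congruent to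
  it modulo degree 5 in the free algebra.  Then the component of degree 5 of \<open>[u, v]\<close> is
  \<open>[[x\<^sub>1, x\<^sub>2]\<^sup>2, x\<^sub>2]\<close>, which is nonzero, a contradiction.
\<close>


section \<open>The filtration of the free algebra by degree\<close>

text \<open>This is the \<open>m\<close>-th power of the two-sided ideal generated by
  \<open>x1\<close> and \<open>x2\<close>.\<close>

definition order_ge :: "nat \<Rightarrow> 'k::field free_alg set" where
  "order_ge m = {f. \<forall>w \<in> Poly_Mapping.keys f. m \<le> length w}"

lemma order_geI: "(\<And>w. length w < m \<Longrightarrow> Poly_Mapping.lookup f w = 0) \<Longrightarrow> f \<in> order_ge m"
  by (force simp: order_ge_def in_keys_iff not_le)

lemma lookup_order_ge: "f \<in> order_ge m \<Longrightarrow> length w < m \<Longrightarrow> Poly_Mapping.lookup f w = 0"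
  by (force simp: order_ge_def in_keys_iff not_le)

lemma zero_order_ge [simp]: "0 \<in> order_ge m"
  by (simp add: order_ge_def)

lemma single_order_ge: "m \<le> length w \<Longrightarrow> Poly_Mapping.single w c \<in> order_ge m"
  by (auto simp: order_ge_def)

lemma order_ge_0 [simp]: "f \<in> order_ge 0"
  by (simp add: order_ge_def)

lemma order_ge_mono: "f \<in> order_ge n \<Longrightarrow> m \<le> n \<Longrightarrow> f \<in> order_ge m"
  by (force simp: order_ge_def)

lemma add_order_ge: "f \<in> order_ge m \<Longrightarrow> g \<in> order_ge m \<Longrightarrow> f + g \<in> order_ge m"
  by (rule order_geI) (simp add: lookup_add lookup_order_ge)

lemma diff_order_ge: "f \<in> order_ge m \<Longrightarrow> g \<in> order_ge m \<Longrightarrow> f - g \<in> order_ge m"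
  by (rule order_geI) (simp add: lookup_minus lookup_order_ge)

lemma sum_order_ge: "(\<And>i. i \<in> S \<Longrightarrow> f i \<in> order_ge m) \<Longrightarrow> sum f S \<in> order_ge m"
  by (induction S rule: infinite_finite_induct) (auto intro: add_order_ge)

lemma mult_order_ge:
  fixes f g :: "'k::field free_alg"
  assumes "f \<in> order_ge m" "g \<in> order_ge n"
  shows "f * g \<in> order_ge (m + n)"
proof -
  have "f * g = (\<Sum>w \<in> Poly_Mapping.keys f. Poly_Mapping.single w (Poly_Mapping.lookup f w)) *
                (\<Sum>w \<in> Poly_Mapping.keys g. Poly_Mapping.single w (Poly_Mapping.lookup g w))"
    by (simp flip: free_alg_expand)
  also have "\<dots> \<in> order_ge (m + n)"
    unfolding sum_product mult_single
    using assms
    by (intro sum_order_ge single_order_ge) (auto simp: plus_list_def order_ge_def add_mono)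
  finally show ?thesis .
qed

lemma mult_order_ge_left: "f \<in> order_ge m \<Longrightarrow> g * f \<in> order_ge m"
  using mult_order_ge[of g 0 f m] by simp

lemma commutator_order_ge:
  "f \<in> order_ge m \<Longrightarrow> g \<in> order_ge n \<Longrightarrow> commutator f g \<in> order_ge (m + n)"
  unfolding commutator_def
  using mult_order_ge[of f m g n] mult_order_ge[of g n f m]
  by (simp add: diff_order_ge add.commute)

lemma x1_order_ge: "x1 \<in> order_ge (Suc 0)" and x2_order_ge: "x2 \<in> order_ge (Suc 0)"
  by (auto simp: x1_def x2_def intro: single_order_ge)

text \<open>Words cancel on the right, so right multiplication by a word only relabels coefficients.
  This is used to raise identities of low degree to degree 4.\<close>

lemma lookup_times_single_append:
  fixes f :: "'k::field free_alg"
  shows "Poly_Mapping.lookup (f * Poly_Mapping.single v 1) (w @ v) = Poly_Mapping.lookup f w"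
  by (induction f rule: free_alg_induct)
     (auto simp: mult_single plus_list_def lookup_single when_def lookup_add distrib_right)

lemma lookup_scal_times:
  "Poly_Mapping.lookup (scal c * f) w = c * Poly_Mapping.lookup f w"
  by (induction f rule: free_alg_induct)
     (auto simp: scal_mult_single lookup_single when_def lookup_add distrib_left)

text \<open>When a word in \<open>x1 + h1\<close> and \<open>x2 + h2\<close> is expanded, every term
  except the original word has a factor \<open>h1\<close> or \<open>h2\<close>, and
  \<open>order_ge m\<close> is an ideal.\<close>

lemma endo_perturbation_order_ge:
  assumes "h1 \<in> order_ge m" "h2 \<in> order_ge m"
  shows "endo (x1 + h1) (x2 + h2) f - f \<in> order_ge m"
proof (induction f rule: free_alg_induct)
  case (single w c)
  have "word_subst (x1 + h1) (x2 + h2) w - Poly_Mapping.single w 1 \<in> order_ge m" for w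
  proof (induction w)
    case Nil
    then show ?case by (simp add: word_subst_def single_Nil_1)
  next
    case (Cons a w)
    define x :: "'a free_alg" where "x = case_letter x1 x2 a"
    define h where "h = case_letter h1 h2 a"
    have h: "h \<in> order_ge m" using assms by (cases a) (auto simp: h_def)
    have s: "Poly_Mapping.single (a # w) 1 = x * Poly_Mapping.single w 1"
      by (cases a) (simp_all add: x_def x1_def x2_def mult_single plus_list_def)
    have "word_subst (x1 + h1) (x2 + h2) (a # w) = (x + h) * word_subst (x1 + h1) (x2 + h2) w"
      by (cases a) (simp_all add: word_subst_def x_def h_def)
    then have "word_subst (x1 + h1) (x2 + h2) (a # w) - Poly_Mapping.single (a # w) 1 =
       x * (word_subst (x1 + h1) (x2 + h2) w - Poly_Mapping.single w 1)
        + h * word_subst (x1 + h1) (x2 + h2) w"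
      by (simp add: s algebra_simps)
    then show ?case
      using mult_order_ge[OF h order_ge_0] mult_order_ge_left[OF Cons]
      by (simp add: add_order_ge)
  qed
  from mult_order_ge_left[OF this] have
    "scal c * (word_subst (x1 + h1) (x2 + h2) w - Poly_Mapping.single w 1) \<in> order_ge m" .
  then show ?case
    by (simp add: endo_single right_diff_distrib scal_mult_single)
next
  case (add f g)
  have "endo (x1 + h1) (x2 + h2) (f + g) - (f + g) =
     (endo (x1 + h1) (x2 + h2) f - f) + (endo (x1 + h1) (x2 + h2) g - g)"
    by (simp add: endo_add)
  then show ?case using add by (simp only: add_order_ge)
qed


section \<open>Identities of small degree\<close>

definition mat2 :: "'k \<Rightarrow> 'k \<Rightarrow> 'k \<Rightarrow> 'k \<Rightarrow> 'k^2^2" where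
  "mat2 a b c d = (\<chi> i j. if i = 1 then if j = 1 then a else b else if j = 1 then c else d)"

lemma mat2_nth [simp]:
  "mat2 a b c d $ 1 $ 1 = a" "mat2 a b c d $ 1 $ 2 = b"
  "mat2 a b c d $ 2 $ 1 = c" "mat2 a b c d $ 2 $ 2 = d"
  by (simp_all add: mat2_def)

lemma mat_eq_mat2: "mat c = mat2 c 0 0 c"
  by (simp add: mat_def vec_eq_iff forall_2)

lemma mat2_mult [simp]:
  "mat2 a b c d ** mat2 a' b' c' d' =
   mat2 (a * a' + b * c') (a * b' + b * d') (c * a' + d * c') (c * b' + d * d' :: 'k::field)"
  by (simp add: matrix_matrix_mult_def vec_eq_iff forall_2 sum_2)

lemma word_eval_scale:
  "word_eval (mat s ** P) (mat s ** Q) w = mat (s ^ length w) ** word_eval P Q w"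
proof (induction w)
  case (Cons a w)
  define R where "R = case_letter P Q a"
  have "word_eval (mat s ** P) (mat s ** Q) (a # w) =
      mat s ** R ** (mat (s ^ length w) ** word_eval P Q w)"
    using Cons by (cases a) (simp_all add: R_def)
  also have "\<dots> = mat s ** (R ** mat (s ^ length w)) ** word_eval P Q w"
    by (simp add: matrix_mul_assoc)
  also have "\<dots> = mat s ** mat (s ^ length w) ** (R ** word_eval P Q w)"
    by (simp add: matrix_mul_assoc flip: mat_central[of _ R])
  finally show ?case by (cases a) (simp_all add: R_def mat_mult_mat)
qed simp

lemma mat_eval_nth:
  "mat_eval P Q f $ i $ j =
     (\<Sum>w \<in> Poly_Mapping.keys f. Poly_Mapping.lookup f w * word_eval P Q w $ i $ j)"
  by (simp add: mat_eval_def mat_nth_mult)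

text \<open>Scaling \<open>P\<close> and \<open>Q\<close> by \<open>s\<close> multiplies the degree
  \<open>d\<close> part by \<open>s ^ d\<close>. As the field is infinite, the parts of different
  degrees vanish separately.\<close>

lemma identity_component:
  fixes f :: "'k::field_char_0 free_alg"
  assumes "f \<in> identities"
  shows "(\<Sum>w \<in> {w. length w = d}. Poly_Mapping.lookup f w * word_eval P Q w $ i $ j) = 0"
proof -
  \<comment> \<open>\<open>p\<close> is the \<open>(i, j)\<close> entry of \<open>f\<close> at \<open>(s P, s Q)\<close>, as a polynomial in \<open>s\<close>.\<close>
  define p where "p = (\<Sum>w \<in> Poly_Mapping.keys f.
    monom (Poly_Mapping.lookup f w * word_eval P Q w $ i $ j) (length w))"
  have "poly p s = mat_eval (mat s ** P) (mat s ** Q) f $ i $ j" for s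
    by (simp add: p_def poly_sum poly_monom mat_eval_nth word_eval_scale
        mult_ac) (simp add: mat_nth_mult mult_ac)
  then have "poly p s = 0" for s
    using assms by (simp add: identities_def)
  then have "p = 0" by (intro iffD1[OF poly_all_0_iff_0] allI)
  then have "0 = coeff p d" by simp
  also have "\<dots> = (\<Sum>w \<in> Poly_Mapping.keys f.
      if length w = d then Poly_Mapping.lookup f w * word_eval P Q w $ i $ j else 0)"
    by (simp add: p_def coeff_sum)
  also have "\<dots> = (\<Sum>w \<in> Poly_Mapping.keys f \<inter> {w. length w = d}.
      Poly_Mapping.lookup f w * word_eval P Q w $ i $ j)"
    by (simp add: sum.inter_restrict)
  also have "\<dots> = (\<Sum>w \<in> {w. length w = d}. Poly_Mapping.lookup f w * word_eval P Q w $ i $ j)"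
  proof (rule sum.mono_neutral_left)
    have "finite {w. set w \<subseteq> {X1, X2} \<and> length w = d}" by (rule finite_lists_length_eq) simp
    moreover have "set w \<subseteq> {X1, X2}" for w using letter.exhaust by blast
    ultimately show "finite {w :: letter list. length w = d}" by simp
  qed (auto simp: in_keys_iff)
  finally show ?thesis by simp
qed

lemma identity_degree_4:
  fixes f :: "'k::field_char_0 free_alg"
  assumes "f \<in> identities" "length w = 4"
  shows "Poly_Mapping.lookup f w = 0"
proof -
  have words: "{w :: letter list. length w = 4} = set (List.n_lists 4 [X1, X2])"
    using letter.exhaust by (auto simp: set_n_lists)
  have e: "(\<Sum>w \<leftarrow> List.n_lists 4 [X1, X2].
      Poly_Mapping.lookup f w * word_eval P Q w $ i $ j) = 0" for P Q i j
    using identity_component[OF assms(1), where d = 4] unfolding words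
    by (subst sum_list_distinct_conv_sum_set) (simp_all add: distinct_n_lists)
  have four: "(4::nat) = Suc (Suc (Suc (Suc 0)))" by simp
  let ?E11 = "mat2 1 0 0 0 :: 'k^2^2" and ?E12 = "mat2 0 1 0 0 :: 'k^2^2"
  let ?E21 = "mat2 0 0 1 0 :: 'k^2^2" and ?O = "mat2 0 0 0 0 :: 'k^2^2"
  let ?S = "mat2 0 1 1 0 :: 'k^2^2" and ?T = "mat2 1 1 0 0 :: 'k^2^2"
  note mat_eq_mat2 [simp]
  \<comment> \<open>The 16 equations are triangular: in this order each contains exactly one
    coefficient not yet known to vanish. The first eight isolate single words: 1212, 2121, 1111,
    2222, 1112, 2111, 2221, 1222. Those with the swap \<open>?S\<close> then give 2112, 2212, 2122,
    1221, 1121, 1211. A product of factors \<open>?E11\<close> and \<open>?T\<close> equals its last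
    factor, which leaves 1122 and 2211.\<close>
  note vanishing =
    e[of ?E12 ?E21 1 1] e[of ?E12 ?E21 2 2] e[of ?E11 ?O 1 1] e[of ?O ?E11 1 1]
    e[of ?E11 ?E12 1 2] e[of ?E11 ?E21 2 1] e[of ?E12 ?E11 1 2] e[of ?E21 ?E11 2 1]
    e[of ?E11 ?S 2 2] e[of ?E11 ?S 1 2] e[of ?E11 ?S 2 1] e[of ?S ?E11 2 2]
    e[of ?S ?E11 1 2] e[of ?S ?E11 2 1] e[of ?E11 ?T 1 2] e[of ?T ?E11 1 2]
  have w: "w \<in> set (List.n_lists 4 [X1, X2])" using assms(2) words by blast
  show ?thesis
    using w[unfolded four List.n_lists.simps, simplified]
      vanishing[unfolded four List.n_lists.simps, simplified]
    by auto
qed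

lemma identities_order_ge:
  fixes f :: "'k::field_char_0 free_alg"
  assumes "f \<in> identities"
  shows "f \<in> order_ge 5"
proof (rule order_geI)
  fix w :: "letter list" assume w: "length w < 5"
  \<comment> \<open>Multiplying by a power of \<open>x1\<close> moves the coefficient of \<open>w\<close> to degree 4.\<close>
  define v where "v = replicate (4 - length w) X1"
  have "f * Poly_Mapping.single v 1 \<in> identities"
    using assms by (simp add: identities_def mat_eval_mult)
  moreover have "length (w @ v) = 4" using w by (simp add: v_def)
  ultimately have "Poly_Mapping.lookup (f * Poly_Mapping.single v 1) (w @ v) = 0"
    by (rule identity_degree_4)
  then show "Poly_Mapping.lookup f w = 0" by (simp only: lookup_times_single_append)
qed


lemma endo_scal_times: "endo u v (scal c * f) = scal c * endo u v f"
  using alg_endo_endo[of u v] unfolding alg_endo_def by blast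


section \<open>Endomorphisms of the relatively free algebra\<close>

lemma proj_eq_iff: "proj f = proj g \<longleftrightarrow> f - g \<in> identities"
  by (rule rel_free.abs_eq_iff)

lemma proj_eq_iff_eval: "proj f = proj g \<longleftrightarrow> (\<forall>P Q. mat_eval P Q f = mat_eval P Q g)"
  by (simp add: proj_eq_iff diff_mem_identities)

lemma proj_0 [simp]: "proj 0 = 0" and proj_1 [simp]: "proj 1 = 1"
  by (simp_all add: zero_rel_free_def one_rel_free_def)

lemma proj_add: "proj (f + g) = proj f + proj g"
  by (simp add: plus_rel_free.abs_eq)

lemma proj_mult: "proj (f * g) = proj f * proj g"
  by (simp add: times_rel_free.abs_eq)

lemma proj_power: "proj (f ^ n) = proj f ^ n"
  by (induction n) (simp_all add: proj_mult)

lemma proj_sum: "proj (sum f S) = (\<Sum>i \<in> S. proj (f i))"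
  by (induction S rule: infinite_finite_induct) (simp_all add: proj_add)

lemma rscale_proj: "rscale c (proj f) = proj (scal c * f)"
  by (simp add: rscale_def proj_mult)

lemma proj_surj: obtains f where "b = proj f"
proof -
  have "\<exists>f. b = proj f" by (induction b rule: rel_free.abs_induct) blast
  then show ?thesis using that by blast
qed

lemma proj_identity_diff_order_ge:
  fixes f g :: "'k::field_char_0 free_alg"
  shows "proj f = proj g \<Longrightarrow> f - g \<in> order_ge 5"
  by (simp add: proj_eq_iff identities_order_ge)

lemma alg_endo_diff:
  assumes "alg_endo sm \<phi>"
  shows "\<phi> (a - b) = \<phi> a - \<phi> b"
proof -
  have "\<phi> (a - b + b) = \<phi> (a - b) + \<phi> b" using assms unfolding alg_endo_def by blast
  then show ?thesis by (simp add: eq_diff_eq)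
qed

lemma alg_endo_commutator:
  assumes "alg_endo sm \<phi>"
  shows "\<phi> (commutator a b) = commutator (\<phi> a) (\<phi> b)"
  using assms unfolding commutator_def alg_endo_diff[OF assms] by (simp add: alg_endo_def)

section \<open>Substitutions descend to the relatively free algebra\<close>

lemma mat_eval_scal: "mat_eval P Q (scal c) = mat c"
  by (simp add: scal_def mat_eval_single)

lemma mat_eval_x1 [simp]: "mat_eval P Q x1 = P" and mat_eval_x2 [simp]: "mat_eval P Q x2 = Q"
  by (simp_all add: x1_def x2_def mat_eval_single)

text \<open>Evaluation after a substitution is evaluation at other matrices. Hence identities are
  stable under substitution, which makes \<open>rendo\<close> well defined.\<close>

lemma mat_eval_endo: "mat_eval P Q (endo u v f) = mat_eval (mat_eval P Q u) (mat_eval P Q v) f"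
proof (induction f rule: free_alg_induct)
  case (single w c)
  have "mat_eval P Q (word_subst u v w) = word_eval (mat_eval P Q u) (mat_eval P Q v) w"
  proof (induction w)
    case (Cons a w)
    then show ?case by (cases a) (simp_all add: word_subst_def mat_eval_mult)
  qed (simp add: word_subst_def)
  then show ?case by (simp add: endo_single mat_eval_mult mat_eval_scal mat_eval_single)
qed (simp add: endo_add mat_eval_add)

lift_definition rendo ::
  "'k::field free_alg \<Rightarrow> 'k free_alg \<Rightarrow> 'k rel_free \<Rightarrow> 'k rel_free" is endo
  by (simp add: diff_mem_identities mat_eval_endo)

lemma rendo_proj: "rendo u v (proj f) = proj (endo u v f)"
  by (rule rendo.abs_eq)

lemma rendo_z1 [simp]: "rendo u v z1 = proj u" and rendo_z2 [simp]: "rendo u v z2 = proj v"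
  by (simp_all add: z1_def z2_def rendo_proj)

lemma alg_endo_rendo: "alg_endo rscale (rendo u v)"
  unfolding alg_endo_def
proof (intro conjI allI)
  have E: "alg_endo (\<lambda>c f. scal c * f) (endo u v)" by (rule alg_endo_endo)
  show "rendo u v 1 = 1"
    using E rendo_proj[of u v 1] by (simp add: alg_endo_def)
  fix a b :: "'a rel_free" and c :: 'a
  obtain f g where fg: "a = proj f" "b = proj g" by (metis proj_surj)
  show "rendo u v (a + b) = rendo u v a + rendo u v b"
    using E by (simp add: fg rendo_proj alg_endo_def flip: proj_add)
  show "rendo u v (a * b) = rendo u v a * rendo u v b"
    using E by (simp add: fg rendo_proj alg_endo_def flip: proj_mult)
  show "rendo u v (rscale c a) = rscale c (rendo u v a)"
    by (simp add: fg rscale_proj rendo_proj endo_scal_times)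
qed

text \<open>The images of \<open>z1\<close> and \<open>z2\<close> determine an endomorphism because
  these generate the algebra. Any representatives \<open>u\<close>, \<open>v\<close> serve, so a
  convenient lift may be chosen.\<close>

lemma alg_endo_rel_free_unique:
  assumes "alg_endo rscale \<phi>" "\<phi> z1 = proj u" "\<phi> z2 = proj v"
  shows "\<phi> = rendo u v"
proof
  fix b :: "'a rel_free"
  obtain f where b: "b = proj f" by (rule proj_surj)
  have w: "\<phi> (proj (Poly_Mapping.single w 1)) = proj (word_subst u v w)" for w
  proof (induction w)
    case Nil
    then show ?case using assms(1) by (simp add: word_subst_def alg_endo_def single_Nil_1)
  next
    case (Cons a w)
    have "Poly_Mapping.single (a # w) 1 = (case a of X1 \<Rightarrow> x1 | X2 \<Rightarrow> x2) * Poly_Mapping.single w (1::'a)"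
      by (cases a) (simp_all add: x1_def x2_def mult_single plus_list_def)
    then show ?case using assms Cons
      by (cases a) (simp_all add: alg_endo_def word_subst_def proj_mult z1_def z2_def)
  qed
  have "\<phi> (proj f) = proj (endo u v f)"
  proof (induction f rule: free_alg_induct)
    case (single w c)
    have "\<phi> (rscale c (proj (Poly_Mapping.single w 1))) = rscale c (proj (word_subst u v w))"
      using assms(1) w[of w] unfolding alg_endo_def by metis
    then show ?case by (simp add: rscale_proj scal_mult_single endo_single)
  next
    case (add f g)
    then show ?case using assms(1) by (simp add: alg_endo_def endo_add proj_add)
  qed
  then show "\<phi> b = rendo u v b" by (simp add: b rendo_proj)
qed

lemma rendo_comp: "rendo u v (rendo u' v' b) = rendo (endo u v u') (endo u v v') b"
proof -
  have "alg_endo rscale (\<lambda>b. rendo u v (rendo u' v' b))"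
    using alg_endo_rendo[of u v] alg_endo_rendo[of u' v'] unfolding alg_endo_def by auto
  then have "(\<lambda>b. rendo u v (rendo u' v' b)) = rendo (endo u v u') (endo u v v')"
    by (rule alg_endo_rel_free_unique) (simp_all add: rendo_proj)
  then show ?thesis by (rule fun_cong)
qed

lemma rendo_z1_z2:
  assumes "proj u = z1" "proj v = z2"
  shows "rendo u v b = b"
proof -
  have "alg_endo rscale (\<lambda>b :: 'a rel_free. b)" by (simp add: alg_endo_def)
  then have "(\<lambda>b. b) = rendo u v"
    by (rule alg_endo_rel_free_unique) (simp_all add: assms)
  then show ?thesis by (rule fun_cong[symmetric])
qed

text \<open>Each homogeneous summand is lifted to a polynomial of its own degree, so no lower terms
  appear in the lift of the sum.\<close>

lemma components_from_order_ge:
  assumes "b \<in> components_from m"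
  obtains f where "f \<in> order_ge m" "b = proj f"
proof -
  from assms obtain N c where c: "\<And>n. c n \<in> component n" "b = (\<Sum>n = m..<N. c n)"
    by (auto simp: components_from_def)
  from c(1) have "\<exists>f. c n = proj f \<and> f \<in> order_ge n" for n
    by (fastforce simp: component_def order_ge_def)
  then obtain f where f: "\<And>n. c n = proj (f n)" "\<And>n. f n \<in> order_ge n"
    by metis
  show ?thesis
  proof
    show "(\<Sum>n = m..<N. f n) \<in> order_ge m"
      by (intro sum_order_ge order_ge_mono[OF f(2)]) auto
    show "b = proj (\<Sum>n = m..<N. f n)" by (simp add: c(2) f(1) proj_sum)
  qed
qed


section \<open>Tame automorphisms preserve the commutator up to a scalar\<close>

text \<open>A summand commuting with \<open>v\<close> drops out of the commutator. For an elementary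
  automorphism it is the polynomial in the fixed generator.\<close>

lemma commutator_affine_left:
  assumes "g * v = v * g"
  shows "commutator (scal a * u + g) v = scal a * commutator u v"
proof -
  have "v * (scal a * u) = scal a * (v * u)"
    by (simp add: scal_central[of a v] flip: mult.assoc)
  then show ?thesis
    by (simp add: commutator_def assms distrib_left distrib_right right_diff_distrib mult.assoc)
qed

lemma commutator_swap: "commutator u v = - commutator v u"
  by (simp add: commutator_def)

lemma commutator_affine_right:
  assumes "g * u = u * g"
  shows "commutator u (scal a * v + g) = scal a * commutator u v"
  unfolding commutator_swap[of u] commutator_affine_left[OF assms] by simp

definition free_poly_at :: "'k::field poly \<Rightarrow> 'k free_alg \<Rightarrow> 'k free_alg" where
  "free_poly_at p f = (\<Sum>i \<le> degree p. scal (coeff p i) * f ^ i)"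

lemma poly_at_proj: "poly_at p (proj f) = proj (free_poly_at p f)"
  by (simp add: poly_at_def free_poly_at_def proj_sum rscale_proj flip: proj_power)

lemma free_poly_at_commute: "free_poly_at p f * f = f * free_poly_at p f"
proof -
  have "scal c * f ^ i * f = f * (scal c * f ^ i)" for c i
  proof -
    have "scal c * f ^ i * f = scal c * f * f ^ i"
      by (simp add: mult.assoc power_commutes)
    also have "\<dots> = f * (scal c * f ^ i)"
      unfolding scal_central[of c f] by (rule mult.assoc)
    finally show ?thesis .
  qed
  then show ?thesis by (simp add: free_poly_at_def sum_distrib_left sum_distrib_right)
qed

text \<open>The relation is imposed on some lift to the free algebra. Imposed only modulo identities
  it would not separate: there \<open>(x1 + [x1, x2]\<^sup>2, x2)\<close> also fixes the
  commutator.\<close>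

definition commutator_semi_invariant :: "('k::field rel_free \<Rightarrow> 'k rel_free) set" where
  "commutator_semi_invariant =
     {rendo u v | u v. \<exists>a. commutator u v = scal a * commutator x1 x2}"

lemma commutator_semi_invariantI:
  "commutator u v = scal a * commutator x1 x2 \<Longrightarrow> rendo u v \<in> commutator_semi_invariant"
  unfolding commutator_semi_invariant_def by blast

lemma commutator_semi_invariantE:
  assumes "\<phi> \<in> commutator_semi_invariant"
  obtains u v a where "\<phi> = rendo u v" "commutator u v = scal a * commutator x1 x2"
  using assms unfolding commutator_semi_invariant_def by blast

text \<open>Applying the lift of \<open>\<phi>\<close> to the relation for the lift of
  \<open>\<psi>\<close> multiplies the two scalars.\<close>

lemma commutator_semi_invariant_comp:
  assumes "\<phi> \<in> commutator_semi_invariant" "\<psi> \<in> commutator_semi_invariant"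
  shows "(\<lambda>b. \<phi> (\<psi> b)) \<in> commutator_semi_invariant"
proof -
  obtain u v a where \<phi>: "\<phi> = rendo u v" "commutator u v = scal a * commutator x1 x2"
    using assms(1) by (rule commutator_semi_invariantE)
  obtain u' v' a' where \<psi>: "\<psi> = rendo u' v'" "commutator u' v' = scal a' * commutator x1 x2"
    using assms(2) by (rule commutator_semi_invariantE)
  note E = alg_endo_commutator[OF alg_endo_endo]
  have "commutator (endo u v u') (endo u v v') = endo u v (scal a' * commutator x1 x2)"
    by (simp add: \<psi>(2) flip: E)
  also have "\<dots> = scal a' * commutator u v"
    by (simp add: endo_scal_times E)
  also have "\<dots> = scal (a' * a) * commutator x1 x2"
    by (simp add: \<phi>(2) scal_mult mult.assoc)
  finally show ?thesis
    unfolding \<phi>(1) \<psi>(1) rendo_comp by (rule commutator_semi_invariantI)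
qed

lemma elementary_commutator_semi_invariant:
  assumes "\<phi> \<in> elementary"
  shows "\<phi> \<in> commutator_semi_invariant"
proof -
  from assms obtain \<alpha> f where \<phi>: "alg_endo rscale \<phi>" and
    "\<phi> z1 = rscale \<alpha> z1 + poly_at f z2 \<and> \<phi> z2 = z2 \<or>
     \<phi> z1 = z1 \<and> \<phi> z2 = rscale \<alpha> z2 + poly_at f z1"
    unfolding elementary_def Aut_def by auto
  then consider "\<phi> z1 = rscale \<alpha> z1 + poly_at f z2" "\<phi> z2 = z2"
    | "\<phi> z1 = z1" "\<phi> z2 = rscale \<alpha> z2 + poly_at f z1"
    by blast
  then show ?thesis
  proof cases
    case 1
    then have "\<phi> = rendo (scal \<alpha> * x1 + free_poly_at f x2) x2"
      by (intro alg_endo_rel_free_unique[OF \<phi>])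
         (simp_all add: z1_def z2_def rscale_proj poly_at_proj proj_add)
    then show ?thesis
      using commutator_semi_invariantI[OF commutator_affine_left[OF free_poly_at_commute]] by simp
  next
    case 2
    then have "\<phi> = rendo x1 (scal \<alpha> * x2 + free_poly_at f x1)"
      by (intro alg_endo_rel_free_unique[OF \<phi>])
         (simp_all add: z1_def z2_def rscale_proj poly_at_proj proj_add)
    then show ?thesis
      using commutator_semi_invariantI[OF commutator_affine_right[OF free_poly_at_commute]] by simp
  qed
qed

section \<open>Inverses of elementary automorphisms\<close>

lemma inv_Aut:
  assumes "\<phi> \<in> carrier Aut"
  shows "inv\<^bsub>Aut\<^esub> \<phi> \<in> carrier Aut" "(inv\<^bsub>Aut\<^esub> \<phi>) (\<phi> b) = b"
proof -
  interpret group "Aut :: ('a rel_free \<Rightarrow> 'a rel_free) monoid" by (rule group_Aut)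
  show "inv\<^bsub>Aut\<^esub> \<phi> \<in> carrier Aut" using assms by simp
  have "inv\<^bsub>Aut\<^esub> \<phi> \<circ> \<phi> = id"
    using l_inv[OF assms] by (simp add: Aut_def)
  then show "(inv\<^bsub>Aut\<^esub> \<phi>) (\<phi> b) = b" by (simp add: fun_eq_iff)
qed

lemma free_poly_at_smult: "free_poly_at (smult c p) f = scal c * free_poly_at p f"
  by (cases "c = 0") (simp_all add: free_poly_at_def scal_mult mult.assoc sum_distrib_left)

text \<open>\<open>generate\<close> adjoins inverses of generators. Solving
  \<open>\<alpha> z + f(y)\<close> for \<open>z\<close> shows that the inverse is elementary, with
  \<open>\<alpha>\<close> and \<open>f\<close> replaced by \<open>1/\<alpha>\<close> and
  \<open>-f/\<alpha>\<close>.\<close>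

lemma inv_elementary:
  assumes "\<phi> \<in> elementary"
  shows "inv\<^bsub>Aut\<^esub> \<phi> \<in> elementary"
proof -
  have \<phi>: "\<phi> \<in> carrier Aut" using assms by (simp add: elementary_def)
  define \<psi> where "\<psi> = inv\<^bsub>Aut\<^esub> \<phi>"
  note I = inv_Aut[OF \<phi>, folded \<psi>_def]
  have E: "alg_endo rscale \<psi>" using I(1) by (simp add: Aut_def)
  \<comment> \<open>In the application \<open>z\<close> is the generator that is moved,
    \<open>b\<close> its image under the inverse and \<open>y\<close> the fixed generator.\<close>
  have solve: "b = rscale (inverse a) z + poly_at (smult (- inverse a) f) y"
    if "a \<noteq> 0" "z = rscale a b + poly_at f y" for a z b f and y :: "'a rel_free"
  proof -
    obtain b' y' where *: "b = proj b'" "y = proj y'" by (metis proj_surj)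
    have "scal (inverse a) * (scal a * b') = b'"
      using that(1) by (simp flip: scal_mult mult.assoc)
    moreover have "scal (- inverse a) = - scal (inverse a)"
      using scal_add[of "inverse a" "- inverse a"] by (simp add: eq_neg_iff_add_eq_0 add.commute)
    ultimately have "scal (inverse a) * (scal a * b' + free_poly_at f y') +
        free_poly_at (smult (- inverse a) f) y' = b'"
      by (simp add: free_poly_at_smult distrib_left del: smult_minus_left)
    then show ?thesis
      by (simp add: that(2) * rscale_proj poly_at_proj flip: proj_add)
  qed
  have hom: "\<psi> (rscale a b + poly_at f y) =
      rscale a (\<psi> b) + poly_at f y" if "\<psi> y = y" for a b f y
  proof -
    have "\<psi> (y ^ n) = y ^ n" for n
      using E that by (induction n) (simp_all add: alg_endo_def)
    moreover have "\<psi> 0 = 0"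
      using alg_endo_diff[OF E, of 0 0] by simp
    then have "\<psi> (sum g S) = (\<Sum>i \<in> S. \<psi> (g i))" for g and S :: "nat set"
      using E by (induction S rule: infinite_finite_induct) (simp_all add: alg_endo_def)
    ultimately show ?thesis using E by (simp add: poly_at_def alg_endo_def)
  qed
  from assms obtain \<alpha> f where \<alpha>: "\<alpha> \<noteq> 0" and
    "\<phi> z1 = rscale \<alpha> z1 + poly_at f z2 \<and> \<phi> z2 = z2 \<or>
     \<phi> z1 = z1 \<and> \<phi> z2 = rscale \<alpha> z2 + poly_at f z1"
    by (auto simp: elementary_def)
  then consider "\<phi> z1 = rscale \<alpha> z1 + poly_at f z2" "\<phi> z2 = z2"
    | "\<phi> z1 = z1" "\<phi> z2 = rscale \<alpha> z2 + poly_at f z1"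
    by blast
  then have "\<psi> z1 = rscale (inverse \<alpha>) z1 + poly_at (smult (- inverse \<alpha>) f) z2 \<and>
        \<psi> z2 = z2 \<or>
      \<psi> z1 = z1 \<and>
        \<psi> z2 = rscale (inverse \<alpha>) z2 + poly_at (smult (- inverse \<alpha>) f) z1"
  proof cases
    case 1
    have z2: "\<psi> z2 = z2" using I(2)[of z2] 1(2) by simp
    have "z1 = rscale \<alpha> (\<psi> z1) + poly_at f z2"
      using I(2)[of z1] unfolding 1(1) hom[OF z2] by (rule sym)
    from solve[OF \<alpha> this] z2 show ?thesis by blast
  next
    case 2
    have z1: "\<psi> z1 = z1" using I(2)[of z1] 2(1) by simp
    have "z2 = rscale \<alpha> (\<psi> z2) + poly_at f z1"
      using I(2)[of z2] unfolding 2(2) hom[OF z1] by (rule sym)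
    from solve[OF \<alpha> this] z1 show ?thesis by blast
  qed
  moreover have "inverse \<alpha> \<noteq> 0" using \<alpha> by simp
  ultimately show ?thesis
    using I(1) unfolding elementary_def \<psi>_def[symmetric] by blast
qed

lemma tame_commutator_semi_invariant:
  assumes "\<phi> \<in> tame"
  shows "\<phi> \<in> commutator_semi_invariant"
  using assms unfolding tame_def
proof (induction rule: generate.induct)
  case one
  have "rendo x1 (x2 :: 'a free_alg) \<in> commutator_semi_invariant"
    by (rule commutator_semi_invariantI[where a = 1]) simp
  moreover have "rendo x1 (x2 :: 'a free_alg) = id"
    by (simp add: fun_eq_iff rendo_z1_z2 z1_def z2_def)
  ultimately show ?case by (simp add: Aut_def id_def)
next
  case (eng \<phi> \<psi>)
  from commutator_semi_invariant_comp[OF eng.IH] show ?case by (simp add: Aut_def comp_def)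
qed (simp_all add: elementary_commutator_semi_invariant inv_elementary)


section \<open>The automorphism induced by \<open>(x\<^sub>1 + [x\<^sub>1, x\<^sub>2]\<^sup>2, x\<^sub>2)\<close>\<close>

lemma mat_eval_commutator:
  "mat_eval P Q (commutator f g) =
     mat_eval P Q f ** mat_eval P Q g - mat_eval P Q g ** mat_eval P Q f"
  by (simp add: commutator_def mat_eval_diff mat_eval_mult)

text \<open>A traceless two-by-two matrix \<open>C\<close> satisfies \<open>C\<^sup>2 = - det C\<close> by Cayley--Hamilton.\<close>

lemma commutator_square_scalar:
  fixes P Q :: "'k::field^2^2"
  obtains c where "(P ** Q - Q ** P) ** (P ** Q - Q ** P) = mat c"
proof
  show "(P ** Q - Q ** P) ** (P ** Q - Q ** P) = mat (- det (P ** Q - Q ** P))"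
    by (simp add: det_2 matrix_matrix_mult_def vec_eq_iff forall_2 sum_2 mat_def algebra_simps)
qed

text \<open>Every value of \<open>c\<^sup>2\<close> is a scalar matrix, hence commutes with the
  value of \<open>x2\<close>. For \<open>s = 1\<close> this is Hall's identity
  \<open>[[x1, x2]\<^sup>2, x2]\<close>; the parameter \<open>s\<close> serves the map and its
  inverse together.\<close>

lemma proj_commutator_shift:
  fixes s :: "'k::field"
  defines "c \<equiv> commutator x1 (x2 :: 'k free_alg)"
  shows "proj (commutator (x1 + scal s * c\<^sup>2) x2) = proj c"
  unfolding proj_eq_iff_eval
proof (intro allI)
  fix P Q :: "'k^2^2"
  obtain d where d: "(P ** Q - Q ** P) ** (P ** Q - Q ** P) = mat d"
    by (rule commutator_square_scalar)
  have "mat_eval P Q (x1 + scal s * c\<^sup>2) = P + mat (s * d)"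
    by (simp add: c_def power2_eq_square mat_eval_add mat_eval_mult mat_eval_scal
        mat_eval_commutator d mat_mult_mat)
  then show "mat_eval P Q (commutator (x1 + scal s * c\<^sup>2) x2) = mat_eval P Q c"
    by (simp add: mat_eval_commutator c_def matrix_distrib_right matrix_add_ldistrib mat_central)
qed

text \<open>The outer substitution fixes the class of \<open>c\<close>, so the contributions
  \<open>s\<close> and \<open>- s\<close> times \<open>c\<^sup>2\<close> cancel.\<close>

lemma rendo_shift_inverse:
  fixes s :: "'k::field"
  defines "c \<equiv> commutator x1 (x2 :: 'k free_alg)"
  shows "rendo (x1 + scal s * c\<^sup>2) x2 (rendo (x1 + scal (- s) * c\<^sup>2) x2 b) = b"
proof -
  let ?E = "endo (x1 + scal s * c\<^sup>2) x2"
  have "?E c = commutator (x1 + scal s * c\<^sup>2) x2"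
    unfolding c_def by (simp add: alg_endo_commutator[OF alg_endo_endo])
  then have c: "proj (?E c) = proj c"
    using proj_commutator_shift[of s] by (simp add: c_def)
  have "?E (x1 + scal (- s) * c\<^sup>2) = x1 + scal s * c\<^sup>2 + scal (- s) * (?E c)\<^sup>2"
    unfolding endo_add endo_scal_times by (simp add: endo_mult power2_eq_square)
  then have "proj (?E (x1 + scal (- s) * c\<^sup>2)) = proj (x1 + (scal s + scal (- s)) * c\<^sup>2)"
    by (simp add: proj_add proj_mult proj_power c algebra_simps)
  also have "\<dots> = z1"
    by (simp add: z1_def flip: scal_add)
  finally show ?thesis by (simp add: rendo_comp rendo_z1_z2 z2_def)
qed

lemma bij_rendo_commutator_square:
  "bij (rendo (x1 + (commutator x1 x2)\<^sup>2) (x2 :: 'k::field free_alg))"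
  \<comment> \<open>The parameters 1 and -1 give the two one-sided inverse laws.\<close>
  using rendo_shift_inverse[where 'k = 'k and s = 1] rendo_shift_inverse[where 'k = 'k and s = "- 1"]
  by (intro o_bij[where g = "rendo (x1 + scal (- 1) * (commutator x1 x2)\<^sup>2) x2"])
     (auto simp: fun_eq_iff)

section \<open>The obstruction in degree five\<close>

lemma commutator_square_order_ge: "(commutator x1 x2)\<^sup>2 \<in> order_ge 4"
  using mult_order_ge[OF commutator_order_ge commutator_order_ge,
      OF x1_order_ge x2_order_ge x1_order_ge x2_order_ge]
  by (simp add: power2_eq_square numeral_eq_Suc)

text \<open>The last group collects all terms involving the errors \<open>p\<close> and
  \<open>q\<close>.\<close>

lemma commutator_add_add:
  "commutator (a + b + p) (d + q) = commutator a d + commutator b d +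
     (commutator p d + commutator (a + b) q + commutator p q)"
  by (simp add: commutator_def algebra_simps)

text \<open>Modulo degree 6 the commutator is \<open>c + [c\<^sup>2, x2]\<close>, while a multiple
  of \<open>c\<close> lives in degree 2. In the free algebra \<open>[c\<^sup>2, x2]\<close> is
  nonzero, although it is an identity of the matrix algebra.\<close>

lemma commutator_not_semi_invariant:
  fixes u v :: "'k::field free_alg"
  assumes "u - (x1 + (commutator x1 x2)\<^sup>2) \<in> order_ge 5" "v - x2 \<in> order_ge 5"
  shows "commutator u v \<noteq> scal a * commutator x1 x2"
proof
  assume a: "commutator u v = scal a * commutator x1 x2"
  define c where "c = commutator x1 (x2 :: 'k free_alg)"
  define p where "p = u - (x1 + c\<^sup>2)"
  define q where "q = v - x2"
  have pq: "p \<in> order_ge 5" "q \<in> order_ge 5" using assms by (simp_all add: p_def q_def c_def)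
  have x1c: "x1 + c\<^sup>2 \<in> order_ge 1"
    unfolding c_def
    by (rule add_order_ge order_ge_mono[OF x1_order_ge]
        order_ge_mono[OF commutator_square_order_ge] | simp)+
  have "commutator u v = commutator (x1 + c\<^sup>2 + p) (x2 + q)" by (simp add: p_def q_def)
  then have "scal a * c = c + commutator (c\<^sup>2) x2 +
      (commutator p x2 + commutator (x1 + c\<^sup>2) q + commutator p q)"
    unfolding commutator_add_add a c_def[symmetric] .
  then have eq: "Poly_Mapping.lookup (scal a * c) w = Poly_Mapping.lookup (c + commutator (c\<^sup>2) x2 +
      (commutator p x2 + commutator (x1 + c\<^sup>2) q + commutator p q)) w" for w
    by simp
  \<comment> \<open>Each error of order 5 is bracketed with an element of order at least 1.\<close>
  have r: "commutator p x2 + commutator (x1 + c\<^sup>2) q + commutator p q \<in> order_ge 6"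
    using commutator_order_ge[OF pq(1) x2_order_ge] commutator_order_ge[OF x1c pq(2)]
      order_ge_mono[OF commutator_order_ge[OF pq], of 6]
    by (simp add: add_order_ge)
  \<comment> \<open>This word has coefficient 1 in \<open>c\<^sup>2 * x2\<close> and does not occur
    in \<open>x2 * c\<^sup>2\<close>, whose words all begin with \<open>x2\<close>.\<close>
  let ?w = "[X1, X2, X1, X2, X2]"
  have "Poly_Mapping.lookup c ?w = 0"
    by (simp add: c_def commutator_def x1_def x2_def mult_single plus_list_def lookup_minus
        lookup_single)
  moreover have "Poly_Mapping.lookup (commutator (c\<^sup>2) x2) ?w = 1"
    by (simp add: c_def commutator_def x1_def x2_def mult_single plus_list_def lookup_minus
        lookup_single power2_eq_square left_diff_distrib right_diff_distrib)
  ultimately show False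
    using eq[of ?w] lookup_order_ge[OF r, of ?w] by (simp add: lookup_add lookup_scal_times)
qed

lemma not_approximately_tame_commutator_square:
  "\<not> approximately_tame (rendo (x1 + (commutator x1 x2)\<^sup>2) (x2 :: 'k::field_char_0 free_alg))"
proof
  let ?\<phi> = "rendo (x1 + (commutator x1 x2)\<^sup>2) (x2 :: 'k free_alg)"
  interpret group "Aut :: ('k rel_free \<Rightarrow> 'k rel_free) monoid" by (rule group_Aut)
  assume "approximately_tame ?\<phi>"
  then obtain \<Psi> :: "nat \<Rightarrow> _" where
    "\<forall>k \<ge> 1. \<Psi> k \<in> tame \<and> ?\<phi> \<otimes>\<^bsub>Aut\<^esub> inv\<^bsub>Aut\<^esub> (\<Psi> k) \<in> IA k"
    unfolding approximately_tame_def by blast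
  \<comment> \<open>The index 4 leaves errors of degree at least 5, the same bound as for the
    identities.\<close>
  moreover define \<psi> where "\<psi> = \<Psi> 4"
  ultimately have \<psi>: "\<psi> \<in> tame" and IA: "?\<phi> \<otimes>\<^bsub>Aut\<^esub> inv\<^bsub>Aut\<^esub> \<psi> \<in> IA 4"
    by simp_all
  define \<theta> where "\<theta> = ?\<phi> \<otimes>\<^bsub>Aut\<^esub> inv\<^bsub>Aut\<^esub> \<psi>"
  have "\<psi> \<in> carrier Aut"
    using \<psi> unfolding tame_def
    by (rule generate_in_carrier[rotated]) (simp add: elementary_def subset_iff)
  then have \<theta>\<psi>: "\<theta> (\<psi> b) = ?\<phi> b" for b
    using inv_Aut(2)[of \<psi> b] unfolding \<theta>_def by (simp add: Aut_def)
  obtain u v a where uv: "\<psi> = rendo u v" "commutator u v = scal a * commutator x1 x2"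
    using tame_commutator_semi_invariant[OF \<psi>] by (rule commutator_semi_invariantE)
  from IA have "alg_endo rscale \<theta>"
    "\<theta> z1 - z1 \<in> components_from 5" "\<theta> z2 - z2 \<in> components_from 5"
    unfolding \<theta>_def IA_def by (simp_all add: Aut_def)
  obtain h1 where h1: "h1 \<in> order_ge 5" "\<theta> z1 - z1 = proj h1"
    using \<open>\<theta> z1 - z1 \<in> _\<close> by (rule components_from_order_ge)
  obtain h2 where h2: "h2 \<in> order_ge 5" "\<theta> z2 - z2 = proj h2"
    using \<open>\<theta> z2 - z2 \<in> _\<close> by (rule components_from_order_ge)
  have "\<theta> z1 = proj (x1 + h1)" "\<theta> z2 = proj (x2 + h2)"
    using h1(2) h2(2) by (simp_all add: proj_add z1_def z2_def algebra_simps)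
  with \<open>alg_endo rscale \<theta>\<close> have \<theta>: "\<theta> = rendo (x1 + h1) (x2 + h2)"
    by (rule alg_endo_rel_free_unique)
  \<comment> \<open>Two errors of order 5 occur: \<open>\<theta>\<close> changes \<open>f\<close>
    only from degree 5 on, and an equality of classes lifts up to an identity.\<close>
  have close: "f - g \<in> order_ge 5" if "\<theta> (proj f) = proj g" for f g
  proof -
    have "endo (x1 + h1) (x2 + h2) f - g \<in> order_ge 5"
      using that by (simp add: \<theta> rendo_proj proj_identity_diff_order_ge)
    from diff_order_ge[OF this endo_perturbation_order_ge[OF h1(1) h2(1), of f]] show ?thesis by simp
  qed
  have "u - (x1 + (commutator x1 x2)\<^sup>2) \<in> order_ge 5" "v - x2 \<in> order_ge 5"
    using close \<theta>\<psi>[of z1] \<theta>\<psi>[of z2] by (simp_all add: uv(1))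
  then show False using uv(2) commutator_not_semi_invariant by blast
qed

theorem lemma10:
  fixes \<beta> :: "'k::field_char_0 free_alg \<Rightarrow> 'k free_alg"
  assumes "\<beta> = endo (x1 + (commutator x1 x2)\<^sup>2) x2"
  shows "\<exists>\<phi> \<in> carrier Aut. induces \<beta> \<phi> \<and> absolutely_wild \<phi>"
proof (intro bexI conjI)
  let ?\<phi> = "rendo (x1 + (commutator x1 x2)\<^sup>2) (x2 :: 'k free_alg)"
  show Aut: "?\<phi> \<in> carrier Aut"
    by (simp add: Aut_def alg_endo_rendo bij_rendo_commutator_square)
  show "induces \<beta> ?\<phi>" by (simp add: induces_def assms rendo_proj)
  show "absolutely_wild ?\<phi>"
    using Aut not_approximately_tame_commutator_square by (simp add: absolutely_wild_def)
qed

end
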